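(* Let $A_1, A_2$ be complex square matrices of the same size, and let $\alpha\ge 0$ be a real number with $\|A_1\|\le \alpha/2$ and $\|A_2\|\le \alpha/2$. Then for every integer $n\ge 1$, $$\left\| \left\{ \exp[A_1/n]\,\exp[A_2/n] \right\}^n - \exp\left[ \langle A\rangle + L_A/n \right] \right\| \le \frac{a}{n^2},$$ where $$\langle A\rangle = A_1 + A_2,\qquad L_A = \tfrac12 (A_1A_2 - A_2A_1),\qquad a = \frac{\alpha^3}{3}\,\exp[3\alpha]\,\exp[\alpha^2].$$
   Context: $\exp$ denotes the matrix exponential. $\|\cdot\|$ denotes a submultiplicative matrix norm with $\|I\|=1$ for the identity matrix $I$ (e.g. an operator norm). *)

theory Defs
  imports "HOL-Analysis.Analysis"
begin

text \<open>
  The library's ring operations on \<^typ>\<open>complex ^ 'n ^ 'n\<close> (and hence \<open>*\<close> and \<open>^\<close>) act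
  entrywise, so powers and the exponential are defined here from the matrix product \<open>**\<close>.
\<close>

primrec matpow :: "complex ^ 'n ^ 'n \<Rightarrow> nat \<Rightarrow> complex ^ 'n ^ 'n" where
  "matpow A 0 = mat 1"
| "matpow A (Suc k) = A ** matpow A k"

definition matexp :: "complex ^ 'n ^ 'n \<Rightarrow> complex ^ 'n ^ 'n" where
  "matexp A = (\<Sum>k. matpow A k /\<^sub>R fact k)"

text \<open>
  The norm is an arbitrary one with the stated properties, not the library's \<^const>\<open>norm\<close>
  on this type, which is the Frobenius norm and does not map the identity to 1 in general.
\<close>

definition submult_matrix_norm :: "(complex ^ 'n ^ 'n \<Rightarrow> real) \<Rightarrow> bool" where
  "submult_matrix_norm N \<longleftrightarrow>
     (\<forall>A. 0 \<le> N A) \<and>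
     (\<forall>A. N A = 0 \<longleftrightarrow> A = 0) \<and>
     (\<forall>c A. N (\<chi> i j. c * A $ i $ j) = cmod c * N A) \<and>
     (\<forall>A B. N (A + B) \<le> N A + N B) \<and>
     (\<forall>A B. N (A ** B) \<le> N A * N B) \<and>
     N (mat 1) = 1"

end

theory Submission
  imports Defs
begin

text \<open>
  Put \<open>X = A1 / n\<close>, \<open>Y = A2 / n\<close>, \<open>s = \<alpha> / n\<close> and \<open>D = X + Y + (XY - YX) / 2\<close>. Then
  \<open>exp (A1 + A2 + L / n) = (exp D) ^ n\<close>, so telescoping bounds the error by \<open>n\<close> times
  \<open>N (exp X exp Y - exp D)\<close> times the \<open>(n - 1)\<close>-st power of \<open>exp (s + s\<^sup>2 / 4)\<close>. By the choice of
  the commutator term, \<open>exp X exp Y\<close> and \<open>exp D\<close> agree through second order. Bounding the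
  third-order terms of the two factors separately would give \<open>7 / 12\<close> in place of the required
  \<open>1 / 3\<close>; after cancellation they contribute only \<open>s ^ 3 / 12\<close>, and the room between
  \<open>1 / 12\<close> and \<open>1 / 3\<close> together with the exponential factor absorbs all higher orders.
\<close>

section \<open>Algebra of the matrix product and of matrix powers\<close>

lemma matrix_add_rdistrib: "(A + B) ** C = A ** C + B ** (C :: 'a::semiring_1 ^ 'n ^ 'm)"
  by (simp add: matrix_matrix_mult_def vec_eq_iff distrib_right sum.distrib)

lemma matrix_diff_ldistrib: "A ** (B - C) = A ** B - A ** (C :: 'a::ring_1 ^ 'n ^ 'm)"
  by (simp add: matrix_matrix_mult_def vec_eq_iff right_diff_distrib sum_subtractf)

lemma matrix_diff_rdistrib: "(A - B) ** C = A ** C - B ** (C :: 'a::ring_1 ^ 'n ^ 'm)"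
  by (simp add: matrix_matrix_mult_def vec_eq_iff left_diff_distrib sum_subtractf)

lemma scaleR_matrix_mult_left:
  fixes A :: "'a::real_algebra_1 ^ 'n ^ 'm"
  shows "(c *\<^sub>R A) ** B = c *\<^sub>R (A ** B)"
  by (simp add: matrix_matrix_mult_def vec_eq_iff scaleR_sum_right)

lemma scaleR_matrix_mult_right:
  fixes A :: "'a::real_algebra_1 ^ 'n ^ 'm"
  shows "A ** (c *\<^sub>R B) = c *\<^sub>R (A ** B)"
  by (simp add: matrix_matrix_mult_def vec_eq_iff scaleR_sum_right)

lemmas matrix_expand =
  matrix_add_ldistrib matrix_add_rdistrib matrix_diff_ldistrib matrix_diff_rdistrib
  scaleR_matrix_mult_left scaleR_matrix_mult_right matrix_mul_assoc

lemma matpow_add: "matpow A (j + k) = matpow A j ** matpow A k"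
  by (induction j) (auto simp: matrix_mul_assoc)

lemma matpow_scaleR: "matpow (c *\<^sub>R A) k = c ^ k *\<^sub>R matpow A k"
  by (induction k) (auto simp: scaleR_matrix_mult_left scaleR_matrix_mult_right)

section \<open>The exponential series\<close>

lemma matrix_Cauchy_product_sums:
  fixes f g :: "nat \<Rightarrow> complex ^ 'n ^ 'n"
  assumes f: "summable (\<lambda>k. norm (f k))" and g: "summable (\<lambda>k. norm (g k))"
  shows "(\<lambda>k. \<Sum>i\<le>k. f i ** g (k - i)) sums (suminf f ** suminf g)"
proof -
  have entry_norm: "norm (h k $ i $ j) \<le> norm (h k)" for h :: "nat \<Rightarrow> complex ^ 'n ^ 'n" and i j k
    using order_trans[OF Finite_Cartesian_Product.norm_nth_le[of _ j] Finite_Cartesian_Product.norm_nth_le[of _ i]] .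
  have entry: "summable (\<lambda>k. norm (h k $ i $ j))" "suminf h $ i $ j = (\<Sum>k. h k $ i $ j)"
    if "summable (\<lambda>k. norm (h k))" for h :: "nat \<Rightarrow> complex ^ 'n ^ 'n" and i j
  proof -
    show "summable (\<lambda>k. norm (h k $ i $ j))"
      by (rule summable_comparison_test'[OF that]) (use entry_norm in auto)
    have "bounded_linear (\<lambda>A :: complex ^ 'n ^ 'n. A $ i $ j)"
      by (intro bounded_linear_compose[OF bounded_linear_vec_nth] bounded_linear_vec_nth)
    from bounded_linear.suminf[OF this summable_norm_cancel[OF that]]
    show "suminf h $ i $ j = (\<Sum>k. h k $ i $ j)"
      by simp
  qed
  \<comment> \<open>Each entry of the product is a finite sum over \<open>l\<close> of products of
    scalar series, so the scalar Cauchy product applies; swapping the two finite sums then restores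
    \<open>**\<close>.\<close>
  have "(\<lambda>k. \<Sum>l\<in>UNIV. \<Sum>a\<le>k. f a $ i $ l * g (k - a) $ l $ j)
          sums (\<Sum>l\<in>UNIV. (\<Sum>k. f k $ i $ l) * (\<Sum>k. g k $ l $ j))" for i j
    by (intro sums_sum Cauchy_product_sums entry f g)
  then have "(\<lambda>k. (\<Sum>a\<le>k. f a ** g (k - a)) $ i $ j) sums ((suminf f ** suminf g) $ i $ j)" for i j
    by (subst (asm) sum.swap) (simp add: matrix_matrix_mult_def entry f g)
  then show ?thesis
    unfolding sums_def
    by (intro vec_tendstoI) (simp flip: sum_component)
qed

lemma summable_norm_matexp:
  fixes A :: "complex ^ 'n ^ 'n"
  shows "summable (\<lambda>k. norm (matpow A k /\<^sub>R fact k))"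
proof -
  have "bilinear ((**) :: complex ^ 'n ^ 'n \<Rightarrow> complex ^ 'n ^ 'n \<Rightarrow> complex ^ 'n ^ 'n)"
    by (auto simp: bilinear_def intro!: linearI simp: matrix_expand)
  then have "bounded_bilinear ((**) :: complex ^ 'n ^ 'n \<Rightarrow> complex ^ 'n ^ 'n \<Rightarrow> complex ^ 'n ^ 'n)"
    by (simp add: bilinear_conv_bounded_bilinear)
  then obtain K where K: "K > 0" "\<And>(B :: complex ^ 'n ^ 'n) (C :: complex ^ 'n ^ 'n). norm (B ** C) \<le> norm B * norm C * K"
    using bounded_bilinear.pos_bounded by blast
  \<comment> \<open>The constant \<open>K\<close> goes into the base of the power;
    \<open>norm (mat 1)\<close> is the value at \<open>k = 0\<close>, as this norm need not give the
    identity norm 1.\<close>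
  have pow: "norm (matpow A k) \<le> norm (mat 1 :: complex ^ 'n ^ 'n) * (norm A * K) ^ k" for k
  proof (induction k)
    case (Suc k)
    have "norm (matpow A (Suc k)) \<le> (norm A * K) * norm (matpow A k)"
      using K(2)[of A "matpow A k"] by (simp add: mult_ac)
    also have "\<dots> \<le> (norm A * K) * (norm (mat 1 :: complex ^ 'n ^ 'n) * (norm A * K) ^ k)"
      using K(1) Suc by (intro mult_left_mono) auto
    finally show ?case by (simp add: mult_ac)
  qed simp
  have "summable (\<lambda>k. norm (mat 1 :: complex ^ 'n ^ 'n) * (inverse (fact k) * (norm A * K) ^ k))"
    by (intro summable_mult summable_exp)
  then show ?thesis
    by (rule summable_comparison_test')
      (use pow in \<open>simp add: divide_simps mult_ac\<close>)
qed

lemma matexp_sums: "(\<lambda>k. matpow A k /\<^sub>R fact k) sums matexp A"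
  unfolding matexp_def
  by (rule summable_sums[OF summable_norm_cancel[OF summable_norm_matexp]])

text \<open>Multiples of one matrix commute, so the coefficient of \<open>matpow A k\<close> in the
  Cauchy product is the scalar binomial convolution.\<close>

lemma matexp_add_scaleR:
  "matexp ((p + q) *\<^sub>R A) = matexp (p *\<^sub>R A) ** matexp (q *\<^sub>R A)"
proof -
  have "(\<Sum>i\<le>k. (matpow (p *\<^sub>R A) i /\<^sub>R fact i) ** (matpow (q *\<^sub>R A) (k - i) /\<^sub>R fact (k - i)))
      = matpow ((p + q) *\<^sub>R A) k /\<^sub>R fact k" (is "?L = _") for k
  proof -
    have "?L = (\<Sum>i\<le>k. (p ^ i /\<^sub>R fact i * (q ^ (k - i) /\<^sub>R fact (k - i))) *\<^sub>R matpow A k)"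
      by (intro sum.cong)
        (auto simp: matpow_scaleR matrix_expand mult_ac simp flip: matpow_add)
    also have "\<dots> = ((p + q) ^ k /\<^sub>R fact k) *\<^sub>R matpow A k"
      using exp_series_add_commuting[of p q k] by (simp flip: scaleR_sum_left)
    finally show ?thesis
      by (simp add: matpow_scaleR)
  qed
  then have "(\<lambda>k. matpow ((p + q) *\<^sub>R A) k /\<^sub>R fact k) sums (matexp (p *\<^sub>R A) ** matexp (q *\<^sub>R A))"
    using matrix_Cauchy_product_sums[OF summable_norm_matexp[of "p *\<^sub>R A"] summable_norm_matexp[of "q *\<^sub>R A"]]
    by (simp flip: matexp_def)
  with matexp_sums show ?thesis
    by (rule sums_unique2)
qed

lemma matexp_0 [simp]: "matexp 0 = (mat 1 :: complex ^ 'n ^ 'n)"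
proof -
  have terms: "matpow 0 k /\<^sub>R fact k = (if k = 0 then mat 1 else 0 :: complex ^ 'n ^ 'n)" for k
    by (cases k) auto
  have "(\<lambda>k. matpow 0 k /\<^sub>R fact k) sums (mat 1 :: complex ^ 'n ^ 'n)"
    unfolding terms by (rule sums_single)
  with matexp_sums show ?thesis
    by (rule sums_unique2)
qed

lemma matexp_of_nat_scaleR: "matexp (real m *\<^sub>R A) = matpow (matexp A) m"
proof (induction m)
  case (Suc m)
  then show ?case
    using matexp_add_scaleR[of 1 "real m" A] by simp
qed simp

section \<open>Estimates in a submultiplicative norm\<close>

locale matrix_norm =
  fixes N :: "complex ^ 'n ^ 'n \<Rightarrow> real"
  assumes submult_norm: "submult_matrix_norm N"
begin

lemma
  shows nonneg: "0 \<le> N A"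
    and triangle: "N (A + B) \<le> N A + N B"
    and submult: "N (A ** B) \<le> N A * N B"
    and mat_1 [simp]: "N (mat 1) = 1"
    and zero [simp]: "N 0 = 0"
  using submult_norm by (auto simp: submult_matrix_norm_def)

lemma scaleR: "N (c *\<^sub>R A) = \<bar>c\<bar> * N A"
proof -
  have "c *\<^sub>R A = (\<chi> i j. complex_of_real c * A $ i $ j)"
    by (simp add: vec_eq_iff complex_eq_iff)
  then show ?thesis
    using submult_norm by (simp add: submult_matrix_norm_def)
qed

lemma add_le: "N A \<le> a \<Longrightarrow> N B \<le> b \<Longrightarrow> N (A + B) \<le> a + b"
  using triangle[of A B] by linarith

lemma diff_le: "N A \<le> a \<Longrightarrow> N B \<le> b \<Longrightarrow> N (A - B) \<le> a + b"
  using triangle[of A "(-1) *\<^sub>R B"] scaleR[of "-1" B] by simp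

lemma mult_le: "N A \<le> a \<Longrightarrow> N B \<le> b \<Longrightarrow> N (A ** B) \<le> a * b"
  by (meson mult_mono nonneg order_trans submult)

lemma scaleR_le: "N A \<le> a \<Longrightarrow> 0 \<le> c \<Longrightarrow> N (c *\<^sub>R A) \<le> c * a"
  by (simp add: scaleR mult_left_mono)

lemma matpow_le: "N A \<le> a \<Longrightarrow> N (matpow A k) \<le> a ^ k"
  by (induction k) (auto intro: mult_le)

lemma sum_le: "N (sum f S) \<le> (\<Sum>i\<in>S. N (f i))"
proof (induction S rule: infinite_finite_induct)
  case (insert x F)
  then show ?case by (auto intro: add_le)
qed auto

text \<open>The triangle inequality and homogeneity make \<open>N\<close> convex, and convex
  functions on a finite-dimensional space are continuous. This ties \<open>N\<close> to the topology
  in which the series converge.\<close>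

lemma continuous: "continuous_on UNIV N"
proof (rule convex_on_continuous)
  show "convex_on UNIV N"
    by (intro convex_onI) (auto intro!: add_le simp: scaleR)
qed auto

lemma sums_le:
  assumes f: "f sums F" and g: "g sums G" and le: "\<And>k. N (f k) \<le> g k"
  shows "N F \<le> G"
proof (rule LIMSEQ_le)
  show "(\<lambda>m. N (\<Sum>k<m. f k)) \<longlonglongrightarrow> N F"
    using f continuous unfolding sums_def
    by (auto intro: continuous_on_tendsto_compose)
  show "(\<lambda>m. \<Sum>k<m. g k) \<longlonglongrightarrow> G"
    using g by (simp add: sums_def)
  show "\<exists>M. \<forall>m\<ge>M. N (\<Sum>k<m. f k) \<le> (\<Sum>k<m. g k)"
    by (intro exI allI impI order_trans[OF sum_le] sum_mono le)
qed

lemma exp_term_le: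
  assumes "N A \<le> a"
  shows "N (matpow A k /\<^sub>R fact k) \<le> a ^ k /\<^sub>R fact k"
  using scaleR_le[OF matpow_le[OF assms], of "inverse (fact k)" k] by simp

text \<open>Since \<open>fact m * fact k \<le> fact (k + m)\<close>, the factor
  \<open>a ^ m / fact m\<close> can be drawn out of the tail, leaving the series of
  \<open>exp a\<close>. The case \<open>m = 0\<close> bounds the exponential itself,
  \<open>m = 4\<close> the remainder after the cubic terms.\<close>

lemma matexp_tail_le:
  assumes "N A \<le> a"
  shows "N (matexp A - (\<Sum>k<m. matpow A k /\<^sub>R fact k)) \<le> a ^ m / fact m * exp a"
proof (rule sums_le)
  have a: "0 \<le> a"
    using assms nonneg[of A] by linarith
  show "(\<lambda>k. matpow A (k + m) /\<^sub>R fact (k + m)) sums (matexp A - (\<Sum>k<m. matpow A k /\<^sub>R fact k))"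
    by (rule sums_split_initial_segment[OF matexp_sums])
  show "(\<lambda>k. a ^ m / fact m * (a ^ k /\<^sub>R fact k)) sums (a ^ m / fact m * exp a)"
    by (intro sums_mult exp_converges)
  show "N (matpow A (k + m) /\<^sub>R fact (k + m)) \<le> a ^ m / fact m * (a ^ k /\<^sub>R fact k)" for k
  proof -
    have fact: "fact m * fact k \<le> (fact (k + m) :: real)"
      by (metis add.commute fact_fact_dvd_fact dvd_imp_le fact_gt_zero of_nat_fact of_nat_le_iff of_nat_mult)
    have "N (matpow A (k + m) /\<^sub>R fact (k + m)) \<le> a ^ (k + m) / fact (k + m)"
      using exp_term_le[OF assms, of "k + m"] by (simp add: divide_inverse_commute)
    also have "\<dots> \<le> a ^ (k + m) / (fact m * fact k)"
      using a fact by (intro divide_left_mono) auto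
    also have "\<dots> = a ^ m / fact m * (a ^ k /\<^sub>R fact k)"
      by (simp add: power_add divide_simps)
    finally show ?thesis .
  qed
qed

lemma matexp_le: "N A \<le> a \<Longrightarrow> N (matexp A) \<le> exp a"
  using matexp_tail_le[of A a 0] by simp

lemma matexp_partial_le:
  assumes "N A \<le> a"
  shows "N (\<Sum>k<m. matpow A k /\<^sub>R fact k) \<le> exp a"
proof -
  have "N (\<Sum>k<m. matpow A k /\<^sub>R fact k) \<le> (\<Sum>k<m. a ^ k /\<^sub>R fact k)"
    by (intro order_trans[OF sum_le] sum_mono exp_term_le assms)
  also have "\<dots> \<le> exp a"
    using assms nonneg[of A] unfolding exp_def
    by (intro sum_le_suminf summable_exp_generic) auto
  finally show ?thesis .
qed

text \<open>Telescoping: exchanging \<open>P\<close> for \<open>Q\<close> one factor at a time gives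
  \<open>m\<close> terms, each with one factor \<open>P - Q\<close> and \<open>m - 1\<close> factors
  bounded by \<open>M\<close>.\<close>

lemma matpow_diff_le:
  assumes P: "N P \<le> M" and Q: "N Q \<le> M"
  shows "N (matpow P m - matpow Q m) \<le> real m * N (P - Q) * M ^ (m - 1)"
proof (induction m)
  case (Suc m)
  have "matpow P (Suc m) - matpow Q (Suc m)
      = P ** (matpow P m - matpow Q m) + (P - Q) ** matpow Q m"
    by (simp add: matrix_expand)
  also have "N \<dots> \<le> M * (real m * N (P - Q) * M ^ (m - 1)) + N (P - Q) * M ^ m"
    by (intro add_le mult_le P Suc matpow_le Q order_refl)
  also have "\<dots> = real (Suc m) * N (P - Q) * M ^ (Suc m - 1)"
    \<comment> \<open>For \<open>m = 0\<close> the exponent \<open>m - 1\<close> is truncated, but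
      the factor \<open>real m\<close> vanishes.\<close>
    by (cases m) (auto simp: algebra_simps)
  finally show ?case .
qed simp

section \<open>Local error of one step\<close>

lemma matexp_product_diff_le:
  assumes X: "N X \<le> s / 2" and Y: "N Y \<le> s / 2"
  defines "D \<equiv> X + Y + (1 / 2) *\<^sub>R (X ** Y - Y ** X)"
  shows "N D \<le> s + s\<^sup>2 / 4"
    and "N (matexp X ** matexp Y - matexp D) \<le> s ^ 3 / 3 * exp (3 * s + s\<^sup>2)"
proof -
  define x where "x = s / 2"
  define Z where "Z = X + Y"
  define C where "C = (1 / 2) *\<^sub>R (X ** Y - Y ** X)"
  define T where "T W = (\<Sum>k<4. matpow W k /\<^sub>R fact k)" for W :: "complex ^ 'n ^ 'n"
  define u where "u = s + s\<^sup>2 / 4"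
  have X: "N X \<le> x" and Y: "N Y \<le> x"
    using X Y by (auto simp: x_def)
  have s: "0 \<le> s"
    using X nonneg[of X] by (simp add: x_def)
  have T: "T W = mat 1 + W + (1 / 2) *\<^sub>R (W ** W) + (1 / 6) *\<^sub>R (W ** W ** W)" for W
    by (simp add: T_def eval_nat_numeral matrix_mul_assoc fact_numeral)
  have D: "D = Z + C"
    by (simp add: D_def Z_def C_def)
  have Z: "N Z \<le> s"
    using add_le[OF X Y] by (simp add: Z_def x_def)
  have "N C \<le> 1 / 2 * (x * x + x * x)"
    unfolding C_def by (intro scaleR_le diff_le mult_le X Y) auto
  then have C: "N C \<le> s\<^sup>2 / 4"
    by (simp add: x_def power2_eq_square)
  show Du: "N D \<le> s + s\<^sup>2 / 4"
    unfolding D by (intro add_le Z C)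
  then have Du: "N D \<le> u"
    by (simp add: u_def)

  \<comment> \<open>\<open>G\<close> is the third-order part of \<open>exp X exp Y - exp D\<close>; \<open>H\<close> and \<open>J\<close> collect the words of order
    at least four in the products of the truncated series.\<close>
  define G where "G = (1 / 12) *\<^sub>R (X ** X ** Y + X ** Y ** Y + Y ** X ** X + Y ** Y ** X
      - 2 *\<^sub>R (X ** Y ** X) - 2 *\<^sub>R (Y ** X ** Y))"
  define H where "H = X ** ((1 / 6) *\<^sub>R (Y ** Y ** Y))
      + ((1 / 2) *\<^sub>R (X ** X)) ** ((1 / 2) *\<^sub>R (Y ** Y) + (1 / 6) *\<^sub>R (Y ** Y ** Y))
      + ((1 / 6) *\<^sub>R (X ** X ** X)) ** (Y + (1 / 2) *\<^sub>R (Y ** Y) + (1 / 6) *\<^sub>R (Y ** Y ** Y))"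
  define J where "J = (1 / 2) *\<^sub>R (C ** C)
      + (1 / 6) *\<^sub>R (D ** D ** C + D ** C ** Z + C ** Z ** Z)"
  \<comment> \<open>The bracket in \<open>J\<close> is \<open>D ** D ** D - Z ** Z ** Z\<close>,
    telescoped. The cubic words left over form \<open>G\<close>, which is the
    Baker-Campbell-Hausdorff term \<open>([X,[X,Y]] + [Y,[Y,X]]) / 12\<close>.\<close>
  have split: "T X ** T Y - T D = G + H - J"
    by (simp add: T G_def H_def J_def D Z_def C_def matrix_expand vec_eq_iff)
       (simp add: field_simps scaleR_conv_of_real)

  \<comment> \<open>Eight cubic words, counted with multiplicity, each at most
    \<open>x ^ 3 = s ^ 3 / 8\<close>.\<close>
  have "N G \<le> 1 / 12 * (x * x * x + x * x * x + x * x * x + x * x * x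
      + 2 * (x * x * x) + 2 * (x * x * x))"
    unfolding G_def by (intro scaleR_le add_le diff_le mult_le X Y) auto
  then have G: "N G \<le> s ^ 3 / 12"
    by (simp add: x_def eval_nat_numeral)
  have "N H \<le> x * (1 / 6 * (x * x * x))
      + (1 / 2 * (x * x)) * (1 / 2 * (x * x) + 1 / 6 * (x * x * x))
      + (1 / 6 * (x * x * x)) * (x + 1 / 2 * (x * x) + 1 / 6 * (x * x * x))"
    unfolding H_def by (intro scaleR_le add_le mult_le X Y) auto
  also have "\<dots> = 7 / 192 * s ^ 4 + s ^ 5 / 192 + s ^ 6 / 2304"
    by (simp add: x_def field_simps eval_nat_numeral)
  finally have H: "N H \<le> 7 / 192 * s ^ 4 + s ^ 5 / 192 + s ^ 6 / 2304" .
  have "N J \<le> 1 / 2 * (s\<^sup>2 / 4 * (s\<^sup>2 / 4))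
      + 1 / 6 * (u * u * (s\<^sup>2 / 4) + u * (s\<^sup>2 / 4) * s + s\<^sup>2 / 4 * s * s)"
    unfolding J_def by (intro scaleR_le add_le mult_le C Du Z) auto
  also have "\<dots> = 5 / 32 * s ^ 4 + s ^ 5 / 32 + s ^ 6 / 384"
    by (simp add: u_def field_simps eval_nat_numeral)
  finally have J: "N J \<le> 5 / 32 * s ^ 4 + s ^ 5 / 32 + s ^ 6 / 384" .

  have tail: "N (matexp W - T W) \<le> w ^ 4 / 24 * exp w" if "N W \<le> w" for W w
    using matexp_tail_le[OF that, of 4] by (simp add: T_def fact_numeral)
  \<comment> \<open>The exponentials are replaced by their cubic truncations one at a time, so each
    remainder costs order \<open>s ^ 4\<close>.\<close>
  have "matexp X ** matexp Y - matexp D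
      = (T X ** T Y - T D) + ((matexp X - T X) ** matexp Y + T X ** (matexp Y - T Y))
        - (matexp D - T D)"
    by (simp add: matrix_expand)
  also have "N \<dots> \<le> (N G + N H + N J)
      + (x ^ 4 / 24 * exp x * exp x + exp x * (x ^ 4 / 24 * exp x)) + u ^ 4 / 24 * exp u"
    unfolding split
    by (intro add_le diff_le mult_le tail matexp_le X Y Du order_refl)
      (use matexp_partial_le[OF X, of 4] in \<open>simp add: T_def\<close>)
  also have "x ^ 4 / 24 * exp x * exp x + exp x * (x ^ 4 / 24 * exp x) = s ^ 4 / 192 * exp s"
    by (simp add: x_def field_simps flip: exp_add)
  finally have main: "N (matexp X ** matexp Y - matexp D) \<le> s ^ 3 / 12
      + (37 / 192 * s ^ 4 + 7 / 192 * s ^ 5 + 7 / 2304 * s ^ 6)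
      + s ^ 4 / 192 * exp s + u ^ 4 / 24 * exp u"
    using G H J by simp

  \<comment> \<open>\<open>E\<close> is chosen for \<open>u ^ 4 * exp u \<le> s ^ 4 * E\<close>:
    from \<open>u \<le> s * exp (s / 4)\<close> comes \<open>u ^ 4 \<le> s ^ 4 * exp s\<close>, and
    the exponents \<open>s\<close> and \<open>u\<close> add up to that of \<open>E\<close>.\<close>
  define E where "E = exp (2 * s + s\<^sup>2 / 4)"
  have E: "1 + 2 * s + 2 * s\<^sup>2 \<le> E"
  proof -
    have "1 + 2 * s + 2 * s\<^sup>2 \<le> exp (2 * s)"
      using exp_lower_Taylor_quadratic[of "2 * s"] s by (simp add: power2_eq_square)
    also have "\<dots> \<le> E"
      by (simp add: E_def)
    finally show ?thesis .
  qed
  have "u ^ 4 * exp u \<le> s ^ 4 * E"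
  proof -
    have "u = s * (1 + s / 4)"
      by (simp add: u_def power2_eq_square algebra_simps)
    also have "\<dots> \<le> s * exp (s / 4)"
      using s by (intro mult_left_mono exp_ge_add_one_self)
    finally have "u ^ 4 \<le> (s * exp (s / 4)) ^ 4"
      using s by (intro power_mono) (auto simp: u_def)
    then have "u ^ 4 * exp u \<le> s ^ 4 * exp s * exp u"
      by (intro mult_right_mono) (simp_all add: power_mult_distrib flip: exp_of_nat_mult)
    also have "\<dots> = s ^ 4 * E"
      by (simp add: E_def u_def mult.assoc flip: exp_add)
    finally show ?thesis .
  qed
  moreover have "s ^ 4 * exp s \<le> s ^ 4 * E"
    using s by (auto simp: E_def intro!: mult_left_mono)
  ultimately have "N (matexp X ** matexp Y - matexp D) \<le> s ^ 3 / 12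
      + s ^ 4 * (37 / 192 + 7 / 192 * s + 7 / 2304 * s\<^sup>2) + s ^ 4 * E / 192 + s ^ 4 * E / 24"
    using main by (simp add: algebra_simps eval_nat_numeral)
  \<comment> \<open>The quadratic lower bound on \<open>E\<close>, divided by 4, dominates the
    polynomial coefficient by coefficient.\<close>
  also have "\<dots> \<le> s ^ 3 / 12 * E + s ^ 4 * (1 / 4 * E) + s ^ 4 * E / 192 + s ^ 4 * E / 24"
  proof -
    have "1 \<le> E"
      using E s zero_le_power2[of s] by linarith
    then have "s ^ 3 / 12 \<le> s ^ 3 / 12 * E"
      using mult_left_mono[of 1 E "s ^ 3 / 12"] s by simp
    moreover have "37 / 192 + 7 / 192 * s + 7 / 2304 * s\<^sup>2 \<le> 1 / 4 * E"
      using E s zero_le_power2[of s] by linarith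
    then have "s ^ 4 * (37 / 192 + 7 / 192 * s + 7 / 2304 * s\<^sup>2) \<le> s ^ 4 * (1 / 4 * E)"
      by (rule mult_left_mono) simp
    ultimately show ?thesis
      by (intro add_mono order_refl)
  qed
  \<comment> \<open>The coefficients of \<open>s ^ 4 * E\<close> add up to \<open>57 / 192\<close>,
    below \<open>1 / 3\<close>.\<close>
  also have "\<dots> \<le> s ^ 3 / 3 * (E * (1 + s))"
    using s by (simp add: E_def field_simps eval_nat_numeral)
  also have "\<dots> \<le> s ^ 3 / 3 * exp (3 * s + s\<^sup>2)"
  proof -
    have "E * (1 + s) \<le> E * exp s"
      by (intro mult_left_mono exp_ge_add_one_self) (simp add: E_def)
    also have "\<dots> \<le> exp (3 * s + s\<^sup>2)"
      by (simp add: E_def flip: exp_add)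
    finally show ?thesis
      using s by (intro mult_left_mono) auto
  qed
  finally show "N (matexp X ** matexp Y - matexp D) \<le> s ^ 3 / 3 * exp (3 * s + s\<^sup>2)" .
qed

end

section \<open>From the local to the global error\<close>

theorem proposition5p1:
  fixes A1 A2 :: "complex ^ 'n ^ 'n"
    and N :: "complex ^ 'n ^ 'n \<Rightarrow> real"
    and \<alpha> :: real and n :: nat
  assumes "submult_matrix_norm N"
    and "\<alpha> \<ge> 0"
    and "N A1 \<le> \<alpha> / 2"
    and "N A2 \<le> \<alpha> / 2"
    and "n \<ge> 1"
  shows "N (matpow (matexp (A1 /\<^sub>R real n) ** matexp (A2 /\<^sub>R real n)) n
            - matexp ((A1 + A2) + ((1 / 2) *\<^sub>R (A1 ** A2 - A2 ** A1)) /\<^sub>R real n))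
         \<le> (\<alpha> ^ 3 / 3 * exp (3 * \<alpha>) * exp (\<alpha>\<^sup>2)) / (real n)\<^sup>2"
proof -
  interpret matrix_norm N
    using assms(1) by unfold_locales
  define s where "s = \<alpha> / real n"
  define X where "X = A1 /\<^sub>R real n"
  define Y where "Y = A2 /\<^sub>R real n"
  define D where "D = X + Y + (1 / 2) *\<^sub>R (X ** Y - Y ** X)"
  define P where "P = matexp X ** matexp Y"
  \<comment> \<open>A common bound for both factors: \<open>N P\<close> is at most
    \<open>exp s\<close>, and the term \<open>s\<^sup>2 / 4\<close> comes from the commutator in
    \<open>D\<close>.\<close>
  define M where "M = exp (s + s\<^sup>2 / 4)"
  have n: "real n \<ge> 1" "real n > 0" and s: "0 \<le> s"
    using assms by (auto simp: s_def)
  have X: "N X \<le> s / 2" and Y: "N Y \<le> s / 2"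
    using assms n by (auto simp: X_def Y_def s_def scaleR field_simps)
  note bounds = matexp_product_diff_le[OF X Y, folded D_def, folded P_def]
  have "N P \<le> exp (s / 2) * exp (s / 2)"
    unfolding P_def by (intro mult_le matexp_le X Y)
  also have "\<dots> \<le> M"
    by (simp add: M_def flip: exp_add)
  finally have PM: "N P \<le> M" .
  have QM: "N (matexp D) \<le> M"
    unfolding M_def by (intro matexp_le bounds)
  \<comment> \<open>The commutator of \<open>X\<close> and \<open>Y\<close> carries
    \<open>1 / n\<close> twice; multiplying by \<open>n\<close> leaves the single
    \<open>1 / n\<close> at the commutator of \<open>A1\<close> and \<open>A2\<close>.\<close>
  have "(A1 + A2) + ((1 / 2) *\<^sub>R (A1 ** A2 - A2 ** A1)) /\<^sub>R real n = real n *\<^sub>R D"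
    using n by (simp add: D_def X_def Y_def matrix_expand scaleR_add_right scaleR_diff_right field_simps)
  then have "N (matpow P n - matexp ((A1 + A2) + ((1 / 2) *\<^sub>R (A1 ** A2 - A2 ** A1)) /\<^sub>R real n))
      = N (matpow P n - matpow (matexp D) n)"
    by (simp add: matexp_of_nat_scaleR)
  also have "\<dots> \<le> real n * N (P - matexp D) * M ^ (n - 1)"
    by (rule matpow_diff_le[OF PM QM])
  also have "\<dots> \<le> real n * (s ^ 3 / 3 * exp (3 * s + s\<^sup>2)) * M ^ (n - 1)"
    using bounds(2) by (intro mult_right_mono mult_left_mono) (auto simp: M_def)
  also have "\<dots> = real n * s ^ 3 / 3 * exp (3 * s + s\<^sup>2 + (real n - 1) * (s + s\<^sup>2 / 4))"
  proof -
    have "M ^ (n - 1) = exp ((real n - 1) * (s + s\<^sup>2 / 4))"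
      unfolding M_def exp_of_nat_mult[symmetric] using assms(5) by (simp add: of_nat_diff)
    then show ?thesis
      by (simp add: exp_add)
  qed
  also have "\<dots> \<le> real n * s ^ 3 / 3 * exp (3 * \<alpha> + \<alpha>\<^sup>2)"
  proof -
    \<comment> \<open>These two terms are exactly the slack between the exponents once
      \<open>\<alpha> = real n * s\<close> is substituted.\<close>
    have "0 \<le> (real n - 1) * (2 * s)" "0 \<le> s\<^sup>2 * ((real n - 1) * (real n + 3 / 4))"
      using n s by auto
    moreover have "\<alpha> = real n * s"
      using n by (simp add: s_def)
    then have "3 * \<alpha> + \<alpha>\<^sup>2 = 3 * s + s\<^sup>2 + (real n - 1) * (s + s\<^sup>2 / 4)
        + (real n - 1) * (2 * s) + s\<^sup>2 * ((real n - 1) * (real n + 3 / 4))"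
      by (simp add: power2_eq_square field_simps)
    ultimately have "3 * s + s\<^sup>2 + (real n - 1) * (s + s\<^sup>2 / 4) \<le> 3 * \<alpha> + \<alpha>\<^sup>2"
      by linarith
    then show ?thesis
      using s by (intro mult_left_mono) auto
  qed
  \<comment> \<open>The rate: \<open>n\<close> local errors of order \<open>s ^ 3\<close> give
    \<open>n * s ^ 3 = \<alpha> ^ 3 / n\<^sup>2\<close>.\<close>
  also have "\<dots> = (\<alpha> ^ 3 / 3 * exp (3 * \<alpha>) * exp (\<alpha>\<^sup>2)) / (real n)\<^sup>2"
    using n by (simp add: s_def exp_add field_simps eval_nat_numeral)
  finally show ?thesis
    by (simp add: P_def X_def Y_def)
qed

end
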